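(* Let $A$ be a real $n\times m$ matrix such that $\min_{\mathbf{y}\in\Delta_m}\max_{\mathbf{x}\in\Delta_n}\mathbf{x}^\top A\mathbf{y}$ has a unique optimal solution $(\mathbf{x}^*,\mathbf{y}^* )$. Then there exists $\eta_0\in(0,1)$ such that for every fixed stepsize $0<\eta<\eta_0$ there is a neighborhood $U=U(\eta)\subset\Delta_n\times\Delta_m\times\Delta_n\times\Delta_m$ of $(\mathbf{x}^*,\mathbf{y}^*,\mathbf{x}^*,\mathbf{y}^* )$ (the intersection of an open ball around this point with $\Delta_n\times\Delta_m\times\Delta_n\times\Delta_m$) such that for all $(\mathbf{x}^1,\mathbf{y}^1,\mathbf{x}^0,\mathbf{y}^0)\in U$, the OMWU dynamics with stepsize $\eta$ started from these initial conditions satisfies $$\lim_{t\to\infty}(\mathbf{x}^t,\mathbf{y}^t,\mathbf{x}^{t-1},\mathbf{y}^{t-1})=(\mathbf{x}^*,\mathbf{y}^*,\mathbf{x}^*,\mathbf{y}^* ).$$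
   Context: $\Delta_n\subset\mathbb{R}^n$ and $\Delta_m\subset\mathbb{R}^m$ are the probability simplices. An optimal solution of the min-max problem is a pair $(\mathbf{x}^*,\mathbf{y}^* )\in\Delta_n\times\Delta_m$ with $\mathbf{x}^\top A\mathbf{y}^*\le \mathbf{x}^{*\top}A\mathbf{y}^*\le\mathbf{x}^{*\top}A\mathbf{y}$ for all $\mathbf{x}\in\Delta_n$, $\mathbf{y}\in\Delta_m$. Optimistic Multiplicative-Weights Update (OMWU) dynamics with stepsize $\eta\in(0,1)$: given $(\mathbf{x}^1,\mathbf{y}^1),(\mathbf{x}^0,\mathbf{y}^0)\in\Delta_n\times\Delta_m$, for $t\ge1$, $$x_i^{t+1}=x_i^t\,\frac{e^{2\eta(A\mathbf{y}^t)_i-\eta(A\mathbf{y}^{t-1})_i}}{\sum_{j=1}^n x_j^t e^{2\eta(A\mathbf{y}^t)_j-\eta(A\mathbf{y}^{t-1})_j}}\ (i\in[n]),\qquad y_i^{t+1}=y_i^t\,\frac{e^{-2\eta(A^\top\mathbf{x}^t)_i+\eta(A^\top\mathbf{x}^{t-1})_i}}{\sum_{j=1}^m y_j^t e^{-2\eta(A^\top\mathbf{x}^t)_j+\eta(A^\top\mathbf{x}^{t-1})_j}}\ (i\in[m]).$$ *)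

theory Defs
  imports "HOL-Analysis.Analysis"
begin

definition prob_simplex :: "(real ^ 'k) set" where
  "prob_simplex = {x. (\<forall>i. 0 \<le> x $ i) \<and> (\<Sum>i\<in>UNIV. x $ i) = 1}"

text \<open>An \<open>n \<times> m\<close> matrix has type \<open>real ^ 'm ^ 'n\<close>;
  the bilinear form \<open>x\<^sup>T A y\<close> is written \<open>x \<bullet> (A *v y)\<close>.
  The \<open>x\<close>-player maximizes and the \<open>y\<close>-player minimizes.\<close>

definition optimal_solution ::
  "real ^ 'm ^ 'n \<Rightarrow> real ^ 'n \<Rightarrow> real ^ 'm \<Rightarrow> bool" where
  "optimal_solution A xs ys \<longleftrightarrow>
     xs \<in> prob_simplex \<and> ys \<in> prob_simplex \<and>
     (\<forall>x\<in>prob_simplex. \<forall>y\<in>prob_simplex.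
        x \<bullet> (A *v ys) \<le> xs \<bullet> (A *v ys) \<and> xs \<bullet> (A *v ys) \<le> xs \<bullet> (A *v y))"

definition unique_optimal_solution ::
  "real ^ 'm ^ 'n \<Rightarrow> real ^ 'n \<Rightarrow> real ^ 'm \<Rightarrow> bool" where
  "unique_optimal_solution A xs ys \<longleftrightarrow>
     optimal_solution A xs ys \<and>
     (\<forall>x y. optimal_solution A x y \<longrightarrow> x = xs \<and> y = ys)"

text \<open>The recursion determines the sequences \<open>X\<close> and \<open>Y\<close>
  from the initial values \<open>X 1\<close>, \<open>Y 1\<close>, \<open>X 0\<close>, \<open>Y 0\<close>.\<close>

definition omwu ::
  "real ^ 'm ^ 'n \<Rightarrow> real \<Rightarrow> (nat \<Rightarrow> real ^ 'n) \<Rightarrow> (nat \<Rightarrow> real ^ 'm) \<Rightarrow> bool" where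
  "omwu A \<eta> X Y \<longleftrightarrow>
     (\<forall>t\<ge>1.
        (\<forall>i. X (t + 1) $ i =
           X t $ i * (exp (2 * \<eta> * (A *v Y t) $ i - \<eta> * (A *v Y (t - 1)) $ i) /
             (\<Sum>j\<in>UNIV. X t $ j *
                exp (2 * \<eta> * (A *v Y t) $ j - \<eta> * (A *v Y (t - 1)) $ j)))) \<and>
        (\<forall>i. Y (t + 1) $ i =
           Y t $ i * (exp (- 2 * \<eta> * (transpose A *v X t) $ i
                            + \<eta> * (transpose A *v X (t - 1)) $ i) /
             (\<Sum>j\<in>UNIV. Y t $ j *
                exp (- 2 * \<eta> * (transpose A *v X t) $ j
                      + \<eta> * (transpose A *v X (t - 1)) $ j)))))"

end

theory Submission
  imports Defs
begin

text \<open>Undoing the last optimistic half-step rewrites OMWU as an extragradient scheme in the relative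
  entropy geometry. For this auxiliary sequence, the relative entropy from the equilibrium plus a
  small multiple of the squared distance to the previous OMWU iterate is a Lyapunov function once
  the stepsize is small compared with the norm of the matrix; it is small near the equilibrium, so
  trajectories stay close, and its decrements force consecutive iterates together. Hence every
  limit point is a fixed point of the multiplicative-weights map near the equilibrium. Uniqueness
  of the equilibrium implies strict complementarity, by which such a fixed point is again a saddle
  point, hence equals the equilibrium.\<close>

section \<open>Saddle points and strict complementarity\<close>

lemma prob_simplex_nonneg: "x \<in> prob_simplex \<Longrightarrow> 0 \<le> x $ i"
  by (simp add: prob_simplex_def)

lemma prob_simplex_sum: "x \<in> prob_simplex \<Longrightarrow> (\<Sum>i\<in>UNIV. x $ i) = 1"
  by (simp add: prob_simplex_def)

lemma prob_simplex_le_1: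
  assumes "x \<in> prob_simplex"
  shows "x $ i \<le> 1"
  using member_le_sum[of i UNIV "\<lambda>i. x $ i"] assms by (simp add: prob_simplex_def)

lemma axis_in_prob_simplex: "axis i 1 \<in> prob_simplex"
  by (simp add: prob_simplex_def axis_def)

lemma inner_transpose_matrix:
  fixes A :: "real ^ 'm ^ 'n"
  shows "y \<bullet> (transpose A *v x) = x \<bullet> (A *v y)"
  by (metis dot_lmul_matrix inner_commute transpose_matrix_vector)

lemma inner_prob_simplex_le:
  assumes "x \<in> prob_simplex" "\<And>i. w $ i \<le> c"
  shows "x \<bullet> w \<le> c"
proof -
  have "x \<bullet> w \<le> (\<Sum>i\<in>UNIV. x $ i * c)"
    unfolding inner_vec_def using assms
    by (auto intro!: sum_mono mult_left_mono simp: prob_simplex_nonneg)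
  then show ?thesis
    using prob_simplex_sum[OF assms(1)] by (simp flip: sum_distrib_right)
qed

lemma inner_prob_simplex_ge:
  assumes "x \<in> prob_simplex" "\<And>i. c \<le> w $ i"
  shows "c \<le> x \<bullet> w"
  using inner_prob_simplex_le[of x "- w" "- c"] assms by simp

text \<open>Bounds against pure strategies average to bounds against mixed ones, and the common
  threshold \<open>v\<close> is then squeezed to equal the payoff of the pair.\<close>

lemma optimal_solutionI:
  fixes A :: "real ^ 'm ^ 'n"
  assumes "x \<in> prob_simplex" "y \<in> prob_simplex"
    and "\<And>i. (A *v y) $ i \<le> v" "\<And>j. v \<le> (transpose A *v x) $ j"
  shows "optimal_solution A x y"
proof -
  have le: "x' \<bullet> (A *v y) \<le> v" if "x' \<in> prob_simplex" for x'
    using inner_prob_simplex_le that assms(3) by blast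
  have ge: "v \<le> x \<bullet> (A *v y')" if "y' \<in> prob_simplex" for y'
    using inner_prob_simplex_ge[OF that assms(4)] by (simp only: inner_transpose_matrix)
  show ?thesis
    unfolding optimal_solution_def using assms(1,2) le ge by (meson order_trans)
qed

lemma optimal_solution_row_le:
  fixes A :: "real ^ 'm ^ 'n"
  assumes "optimal_solution A x y"
  shows "(A *v y) $ i \<le> x \<bullet> (A *v y)"
  using assms axis_in_prob_simplex[of i]
  unfolding optimal_solution_def by (metis inner_axis' inner_real_def mult_1)

lemma minus_matrix_vector_mult:
  fixes A :: "real ^ 'm ^ 'n"
  shows "- A *v x = - (A *v x)"
  by (simp add: matrix_vector_mult_def vec_eq_iff sum_negf)

text \<open>Passing from \<open>A\<close> to \<open>- transpose A\<close> turns the minimizer into a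
  maximizer, so facts proved for the maximizing player transfer to the other one.\<close>

lemma optimal_solution_dual:
  fixes A :: "real ^ 'm ^ 'n"
  shows "optimal_solution (- transpose A) y x \<longleftrightarrow> optimal_solution A x y"
proof -
  have "b \<bullet> (- transpose A *v a) = - (a \<bullet> (A *v b))" for a b
    by (simp only: minus_matrix_vector_mult inner_transpose_matrix inner_minus_right)
  then show ?thesis
    unfolding optimal_solution_def by auto
qed

lemma unique_optimal_solution_dual:
  fixes A :: "real ^ 'm ^ 'n"
  assumes "unique_optimal_solution A xs ys"
  shows "unique_optimal_solution (- transpose A) ys xs"
  using assms unfolding unique_optimal_solution_def optimal_solution_dual by blast

text \<open>The deficits \<open>?v - (A *v y) $ i\<close>, weighted by \<open>x\<close>, are
  nonnegative and sum to zero, so each weighted deficit vanishes.\<close>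

lemma complementary_slackness:
  fixes A :: "real ^ 'm ^ 'n"
  assumes "optimal_solution A x y" "x $ i > 0"
  shows "(A *v y) $ i = x \<bullet> (A *v y)"
proof -
  let ?v = "x \<bullet> (A *v y)"
  have x: "x \<in> prob_simplex" using assms by (simp add: optimal_solution_def)
  have "(\<Sum>i\<in>UNIV. x $ i * (?v - (A *v y) $ i)) = (\<Sum>i\<in>UNIV. x $ i) * ?v - ?v"
    by (simp add: right_diff_distrib sum_subtractf sum_distrib_right inner_vec_def)
  then have "(\<Sum>i\<in>UNIV. x $ i * (?v - (A *v y) $ i)) = 0"
    using prob_simplex_sum[OF x] by simp
  moreover have "0 \<le> x $ i * (?v - (A *v y) $ i)" for i
    using prob_simplex_nonneg[OF x] optimal_solution_row_le[OF assms(1)] by simp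
  ultimately have "x $ i * (?v - (A *v y) $ i) = 0"
    by (simp add: sum_nonneg_eq_0_iff)
  then show ?thesis using assms(2) by simp
qed

text \<open>The dichotomy is whether \<open>- axis k 1\<close> lies in the cone generated by the
  columns of \<open>B\<close> and the unit vectors. Membership yields \<open>y\<close>. Otherwise a
  separating hyperplane, available because a finitely generated cone is closed, has \<open>x\<close>
  as its normal.\<close>

lemma farkas_strict_coordinate:
  fixes B :: "real ^ 'm ^ 'n"
  obtains (primal) x where "\<And>i. 0 \<le> x $ i" "\<And>j. 0 \<le> (transpose B *v x) $ j" "x $ k > 0"
  | (dual) y where "\<And>j. 0 \<le> y $ j" "\<And>i. (B *v y) $ i \<le> 0" "(B *v y) $ k < 0"
proof -
  define S where "S = range (\<lambda>j. column j B) \<union> range (\<lambda>i. axis i (1::real))"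
  define C where "C = convex_cone hull S"
  have cC: "closed C" "convex C" "0 \<in> C"
    unfolding C_def
    by (auto intro!: closed_convex_cone_hull convex_convex_cone_hull convex_cone_hull_contains_0
        simp: S_def)
  show ?thesis
  proof (cases "- axis k 1 \<in> C")
    case True
    \<comment> \<open>The unit vectors act as slack variables, so every point of the cone dominates
      some \<open>B *v y\<close> with nonnegative \<open>y\<close>.\<close>
    define T where "T = {c :: real ^ 'n. \<exists>y. (\<forall>j. 0 \<le> y $ j) \<and> (\<forall>i. (B *v y) $ i \<le> c $ i)}"
    have "S \<subseteq> T"
    proof
      fix c assume "c \<in> S"
      then consider j where "c = column j B" | i where "c = axis i 1"
        unfolding S_def by blast
      then show "c \<in> T"
      proof cases
        case 1
        then show ?thesis unfolding T_def
          by (auto intro!: exI[of _ "axis j 1"] simp: matrix_vector_mul_component inner_axis column_def)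
             (simp add: axis_def)
      next
        case 2
        then show ?thesis unfolding T_def by (auto intro!: exI[of _ 0] simp: axis_def)
      qed
    qed
    moreover have "convex_cone T"
      unfolding convex_cone_iff
    proof (intro conjI ballI allI impI)
      show "0 \<in> T" unfolding T_def by (auto intro!: exI[of _ 0])
    next
      fix a b assume "a \<in> T" "b \<in> T"
      then obtain y z where "\<forall>j. 0 \<le> y $ j" "\<forall>i. (B *v y) $ i \<le> a $ i"
        "\<forall>j. 0 \<le> z $ j" "\<forall>i. (B *v z) $ i \<le> b $ i"
        unfolding T_def by blast
      then show "a + b \<in> T" unfolding T_def
        by (auto intro!: exI[of _ "y + z"] add_mono simp: matrix_vector_right_distrib)
    next
      fix a and c :: real assume "a \<in> T" "0 \<le> c"
      then obtain y where "\<forall>j. 0 \<le> y $ j" "\<forall>i. (B *v y) $ i \<le> a $ i"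
        unfolding T_def by blast
      then show "c *\<^sub>R a \<in> T" unfolding T_def using \<open>0 \<le> c\<close>
        by (auto intro!: exI[of _ "c *\<^sub>R y"] mult_left_mono simp: matrix_vector_mult_scaleR)
    qed
    ultimately have "C \<subseteq> T" unfolding C_def by (rule hull_minimal)
    then obtain y where y: "\<forall>j. 0 \<le> y $ j" "\<And>i. (B *v y) $ i \<le> (- axis k 1 :: real ^ 'n) $ i"
      using True unfolding T_def by blast
    show ?thesis
    proof (rule dual)
      show "(B *v y) $ i \<le> 0" for i
        using y(2)[of i] by (simp add: axis_def split: if_splits)
      show "(B *v y) $ k < 0" using y(2)[of k] by (simp add: axis_def)
    qed (use y in auto)
  next
    case False
    from separating_hyperplane_closed_point[OF cC(2,1) False]
    obtain a b where ab: "a \<bullet> (- axis k 1) < b" "\<And>c. c \<in> C \<Longrightarrow> b < a \<bullet> c" by blast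
    have b: "b < 0" using ab(2)[OF cC(3)] by simp
    have nn: "0 \<le> a \<bullet> c" if "c \<in> C" for c
    proof (rule ccontr)
      assume n: "\<not> 0 \<le> a \<bullet> c"
      \<comment> \<open>The factor is positive and moves \<open>c\<close> onto the hyperplane
        itself, where the strict separation fails.\<close>
      have "(b / (a \<bullet> c)) *\<^sub>R c \<in> C"
        using that n b unfolding C_def
        by (intro convex_cone_hull_mul) (auto intro: divide_nonpos_neg)
      from ab(2)[OF this] show False using n by simp
    qed
    have SC: "S \<subseteq> C" unfolding C_def by (rule hull_subset)
    show ?thesis
    proof (rule primal[of a])
      show "0 \<le> a $ i" for i
        using nn[of "axis i 1"] SC by (auto simp: S_def inner_axis)
      show "0 \<le> (transpose B *v a) $ j" for j
        using nn[of "column j B"] SC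
        by (auto simp: S_def matrix_vector_mul_component inner_commute row_transpose transpose_def column_def)
      show "a $ k > 0" using ab(1) b by (simp add: inner_axis)
    qed
  qed
qed

text \<open>Uniqueness forces strictness: if a pure strategy outside the support were a best response,
  Farkas' lemma would yield either an optimal strategy charging it or an optimal opponent
  against which it is strictly worse.\<close>

lemma strict_complementarity:
  fixes A :: "real ^ 'm ^ 'n"
  assumes uniq: "unique_optimal_solution A xs ys" and "xs $ k = 0"
  shows "(A *v ys) $ k < xs \<bullet> (A *v ys)"
proof -
  define v where "v = xs \<bullet> (A *v ys)"
  have opt: "optimal_solution A xs ys"
    and unq: "\<And>x y. optimal_solution A x y \<Longrightarrow> x = xs \<and> y = ys"
    using uniq by (auto simp: unique_optimal_solution_def)
  have sx: "xs \<in> prob_simplex" "ys \<in> prob_simplex"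
    using opt by (auto simp: optimal_solution_def)
  have row: "(A *v ys) $ i \<le> v" for i
    using optimal_solution_row_le[OF opt] by (simp add: v_def)
  have col: "v \<le> (transpose A *v xs) $ j" for j
    using optimal_solution_row_le[of "- transpose A" ys xs j] opt
    by (simp add: optimal_solution_dual minus_matrix_vector_mult inner_transpose_matrix v_def
        del: transpose_matrix_vector)
  \<comment> \<open>Subtracting the value normalizes the game to value zero. The inequalities become
    homogeneous, so the vectors from Farkas' lemma may be rescaled into the simplex
    afterwards.\<close>
  define B where "B = (\<chi> i j. A $ i $ j - v)"
  have By: "(B *v y) $ i = (A *v y) $ i - v * (\<Sum>j\<in>UNIV. y $ j)" for y i
    by (simp add: B_def matrix_vector_mult_def left_diff_distrib sum_subtractf sum_distrib_left)
  have Bx: "(transpose B *v x) $ j = (transpose A *v x) $ j - v * (\<Sum>i\<in>UNIV. x $ i)" for x j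
    by (simp add: B_def transpose_def matrix_vector_mult_def left_diff_distrib sum_subtractf
        sum_distrib_left)
  show ?thesis
  proof (cases rule: farkas_strict_coordinate[of B k])
    case (primal x)
    define s where "s = (\<Sum>i\<in>UNIV. x $ i)"
    have s: "s > 0"
      unfolding s_def using primal by (intro sum_pos2[of _ k]) auto
    have "x /\<^sub>R s \<in> prob_simplex"
      using primal(1) s by (simp add: prob_simplex_def s_def flip: sum_distrib_left)
    moreover have "v \<le> (transpose A *v (x /\<^sub>R s)) $ j" for j
    proof -
      have "v * s \<le> (transpose A *v x) $ j" using primal(2)[of j]
        by (simp add: Bx s_def del: transpose_matrix_vector)
      then show ?thesis using s
        by (simp only: matrix_vector_mult_scaleR vector_scaleR_component) (simp add: field_simps)
    qed
    ultimately have "x /\<^sub>R s = xs"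
      \<comment> \<open>The rescaled \<open>x\<close> is optimal together with \<open>ys\<close>, so
        uniqueness forbids the positive weight it puts on \<open>k\<close>.\<close>
      using unq optimal_solutionI sx(2) row by blast
    then have "(x /\<^sub>R s) $ k = 0" using assms(2) by simp
    then show ?thesis using primal(3) s by simp
  next
    case (dual y)
    define s where "s = (\<Sum>j\<in>UNIV. y $ j)"
    have "y \<noteq> 0" using dual(3) by auto
    then obtain j where "y $ j \<noteq> 0" by (auto simp: vec_eq_iff)
    then have "y $ j > 0" using dual(1)[of j] by simp
    then have s: "s > 0"
      unfolding s_def using dual(1) by (intro sum_pos2[of _ j]) auto
    have "y /\<^sub>R s \<in> prob_simplex"
      using dual(1) s by (simp add: prob_simplex_def s_def flip: sum_distrib_left)
    moreover have "(A *v (y /\<^sub>R s)) $ i \<le> v" for i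
    proof -
      have "(A *v y) $ i \<le> v * s" using dual(2)[of i] by (simp add: By s_def)
      then show ?thesis using s
        by (simp only: matrix_vector_mult_scaleR vector_scaleR_component) (simp add: field_simps)
    qed
    ultimately have "y /\<^sub>R s = ys"
      using unq optimal_solutionI sx(1) col by blast
    moreover have "(A *v (y /\<^sub>R s)) $ k < v"
    proof -
      have "(A *v y) $ k < v * s" using dual(3) by (simp add: By s_def)
      then show ?thesis using s
        by (simp only: matrix_vector_mult_scaleR vector_scaleR_component) (simp add: field_simps)
    qed
    ultimately show ?thesis by (simp add: v_def)
  qed
qed

section \<open>Exponential reweighting and relative entropy\<close>

text \<open>The exponential tilt behind multiplicative weights. Stepsize and sign are carried by
  \<open>w\<close>, so one map serves both players.\<close>

definition reweight :: "real ^ 'k \<Rightarrow> real ^ 'k \<Rightarrow> real ^ 'k" where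
  "reweight p w = (\<chi> i. p $ i * exp (w $ i) / (\<Sum>j\<in>UNIV. p $ j * exp (w $ j)))"

text \<open>Relative entropy; the junk value \<open>ln (u / 0) = 0\<close> makes it meaningful only when the
  support of \<open>u\<close> is contained in that of \<open>p\<close>.\<close>

definition kl :: "real ^ 'k \<Rightarrow> real ^ 'k \<Rightarrow> real" where
  "kl u p = (\<Sum>i\<in>UNIV. u $ i * ln (u $ i / p $ i))"

lemma reweight_denom_pos:
  assumes "p \<in> prob_simplex"
  shows "0 < (\<Sum>j\<in>UNIV. p $ j * exp (w $ j))"
proof -
  have "\<exists>k. p $ k \<noteq> 0"
    using prob_simplex_sum[OF assms] by (metis sum.neutral zero_neq_one)
  then obtain k where "p $ k > 0"
    using prob_simplex_nonneg[OF assms] by (metis less_eq_real_def)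
  then show ?thesis
    using prob_simplex_nonneg[OF assms] by (intro sum_pos2[of _ k]) auto
qed

lemma reweight_in_prob_simplex:
  assumes "p \<in> prob_simplex"
  shows "reweight p w \<in> prob_simplex"
  using reweight_denom_pos[OF assms, of w] prob_simplex_nonneg[OF assms]
  by (simp add: prob_simplex_def reweight_def flip: sum_divide_distrib)

lemma reweight_pos_iff:
  assumes "p \<in> prob_simplex"
  shows "reweight p w $ i > 0 \<longleftrightarrow> p $ i > 0"
  using reweight_denom_pos[OF assms, of w]
  by (simp add: reweight_def zero_less_divide_iff zero_less_mult_iff not_less order_less_imp_le
      less_asym)

text \<open>The normalizer of the first tilt cancels in the second, so tilts form an additive
  action. This is what allows a half-step to be undone.\<close>

lemma reweight_reweight:
  assumes "p \<in> prob_simplex"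
  shows "reweight (reweight p w) w' = reweight p (w + w')"
proof -
  define Z where "Z = (\<Sum>j\<in>UNIV. p $ j * exp (w $ j))"
  have "Z > 0" unfolding Z_def using reweight_denom_pos[OF assms] .
  have "reweight p w $ i * exp (w' $ i) = p $ i * exp ((w + w') $ i) / Z" for i
    by (simp add: reweight_def Z_def exp_add)
  then show ?thesis using \<open>Z > 0\<close>
    by (simp add: vec_eq_iff reweight_def[of "reweight p w"] reweight_def[of p "w + w'"]
        flip: sum_divide_distrib)
qed

text \<open>A constant factor disappears in the normalization, and coordinates of zero mass do not
  see \<open>w\<close>. With complementary slackness this makes the equilibrium a fixed
  point.\<close>

lemma reweight_const_on_support:
  assumes "p \<in> prob_simplex" "\<And>i. p $ i > 0 \<Longrightarrow> w $ i = c"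
  shows "reweight p w = p"
proof -
  have "p $ i * exp (w $ i) = p $ i * exp c" for i
    using assms prob_simplex_nonneg[OF assms(1), of i] by (cases "p $ i = 0") auto
  then have "reweight p w = (\<chi> i. p $ i * exp c / (\<Sum>j\<in>UNIV. p $ j * exp c))"
    unfolding reweight_def by presburger
  then show ?thesis using prob_simplex_sum[OF assms(1)]
    by (simp add: vec_eq_iff flip: sum_distrib_right)
qed

text \<open>Where \<open>p\<close> is positive, cancelling it from the fixed-point equation leaves
  \<open>exp (w $ i)\<close> equal to the normalizer, which is the same for all coordinates.\<close>

lemma reweight_fixed_point_support:
  assumes "p \<in> prob_simplex" "reweight p w = p" "p $ i > 0" "p $ j > 0"
  shows "w $ i = w $ j"
proof -
  have "exp (w $ k) = (\<Sum>j\<in>UNIV. p $ j * exp (w $ j))" if "p $ k > 0" for k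
    using arg_cong[OF assms(2), of "\<lambda>x. x $ k"] that reweight_denom_pos[OF assms(1), of w]
    by (simp add: reweight_def field_simps)
  then show ?thesis using assms(3,4) by (metis exp_inj_iff)
qed

lemma tendsto_reweight:
  assumes "(f \<longlongrightarrow> p) F" "(g \<longlongrightarrow> w) F" "p \<in> prob_simplex"
  shows "((\<lambda>x. reweight (f x) (g x)) \<longlongrightarrow> reweight p w) F"
  unfolding reweight_def using reweight_denom_pos[OF assms(3), of w]
  by (intro tendsto_intros assms(1,2)) simp

text \<open>The bound \<open>ln x \<le> x - 1\<close> at \<open>x = sqrt (q / p)\<close> compares relative entropy with the
  squared Hellinger distance.\<close>

lemma kl_ge_norm_squared:
  fixes p q :: "real ^ 'k"
  assumes "p \<in> prob_simplex" "q \<in> prob_simplex" "\<And>i. p $ i > 0 \<Longrightarrow> q $ i > 0"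
  shows "(norm (p - q))\<^sup>2 / 4 \<le> kl p q"
proof -
  have p0: "0 \<le> p $ i" "p $ i \<le> 1" and q0: "0 \<le> q $ i" "q $ i \<le> 1" for i
    using assms(1,2) by (simp_all add: prob_simplex_nonneg prob_simplex_le_1)
  have 1: "2 * p $ i - 2 * sqrt (p $ i) * sqrt (q $ i) \<le> p $ i * ln (p $ i / q $ i)" for i
  proof (cases "p $ i = 0")
    case False
    then have p: "p $ i > 0" using p0(1)[of i] by simp
    then have q: "q $ i > 0" using assms(3) by simp
    have "ln (sqrt (q $ i / p $ i)) \<le> sqrt (q $ i / p $ i) - 1"
      using p q by (intro ln_le_minus_one) simp
    then have "ln (q $ i / p $ i) \<le> 2 * sqrt (q $ i / p $ i) - 2"
      using p q by (simp add: ln_sqrt)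
    moreover have "ln (p $ i / q $ i) = - ln (q $ i / p $ i)"
      using p q by (simp add: ln_div)
    ultimately have "2 - 2 * (sqrt (q $ i) / sqrt (p $ i)) \<le> ln (p $ i / q $ i)"
      by (simp add: real_sqrt_divide)
    then have "p $ i * (2 - 2 * (sqrt (q $ i) / sqrt (p $ i))) \<le> p $ i * ln (p $ i / q $ i)"
      using p by (intro mult_left_mono) auto
    moreover have "p $ i / sqrt (p $ i) = sqrt (p $ i)"
      using p by (simp add: real_div_sqrt)
    moreover have "p $ i * (2 - 2 * (sqrt (q $ i) / sqrt (p $ i)))
        = 2 * p $ i - 2 * (p $ i / sqrt (p $ i)) * sqrt (q $ i)"
      by (simp add: right_diff_distrib)
    ultimately show ?thesis by simp
  qed simp
  \<comment> \<open>Factor the difference of squares of the roots; the sum of the two roots is at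
    most 2.\<close>
  have 2: "(p $ i - q $ i)\<^sup>2 / 4 \<le> p $ i + q $ i - 2 * sqrt (p $ i) * sqrt (q $ i)" for i
  proof -
    define a b where "a = sqrt (p $ i)" and "b = sqrt (q $ i)"
    have ab: "0 \<le> a" "a \<le> 1" "0 \<le> b" "b \<le> 1" "a\<^sup>2 = p $ i" "b\<^sup>2 = q $ i"
      using p0[of i] q0[of i] by (auto simp: a_def b_def)
    have "(a + b)\<^sup>2 \<le> 2\<^sup>2" using ab by (intro power_mono) auto
    then have "(a - b)\<^sup>2 * (a + b)\<^sup>2 \<le> (a - b)\<^sup>2 * 4" by (intro mult_left_mono) auto
    moreover have "(a\<^sup>2 - b\<^sup>2)\<^sup>2 = (a - b)\<^sup>2 * (a + b)\<^sup>2"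
      by (simp add: power2_eq_square algebra_simps)
    ultimately have "(a\<^sup>2 - b\<^sup>2)\<^sup>2 / 4 \<le> a\<^sup>2 + b\<^sup>2 - 2 * a * b"
      by (simp add: power2_diff)
    then show ?thesis by (simp only: ab) (simp add: a_def b_def)
  qed
  have "(norm (p - q))\<^sup>2 / 4 = (\<Sum>i\<in>UNIV. (p $ i - q $ i)\<^sup>2 / 4)"
    unfolding power2_norm_eq_inner inner_vec_def
    by (simp add: power2_eq_square flip: sum_divide_distrib)
  also have "\<dots> \<le> (\<Sum>i\<in>UNIV. p $ i + q $ i - 2 * sqrt (p $ i) * sqrt (q $ i))"
    using 2 by (intro sum_mono)
  \<comment> \<open>Both vectors have total mass 1, so \<open>q $ i\<close> may be traded for
    \<open>p $ i\<close> under the sum.\<close>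
  also have "\<dots> = (\<Sum>i\<in>UNIV. 2 * p $ i - 2 * sqrt (p $ i) * sqrt (q $ i))"
    using prob_simplex_sum[OF assms(1)] prob_simplex_sum[OF assms(2)]
    by (simp add: sum_subtractf sum.distrib flip: sum_distrib_left)
  also have "\<dots> \<le> kl p q" unfolding kl_def using 1 by (intro sum_mono)
  finally show ?thesis .
qed

lemma kl_self: "kl u u = 0"
  by (auto simp: kl_def intro!: sum.neutral)

text \<open>On the support of \<open>u\<close>, tilting adds \<open>w $ i\<close> minus the
  logarithm of the normalizer to the log-density; averaging against \<open>u\<close>, of mass 1,
  gives the formula.\<close>

lemma kl_reweight:
  fixes u p w :: "real ^ 'k"
  assumes "u \<in> prob_simplex" "p \<in> prob_simplex" "\<And>i. u $ i > 0 \<Longrightarrow> p $ i > 0"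
  shows "kl u (reweight p w) = kl u p - u \<bullet> w + ln (\<Sum>j\<in>UNIV. p $ j * exp (w $ j))"
proof -
  define Z where "Z = (\<Sum>j\<in>UNIV. p $ j * exp (w $ j))"
  have Z: "Z > 0" unfolding Z_def using reweight_denom_pos[OF assms(2)] .
  have "u $ i * ln (u $ i / reweight p w $ i)
      = u $ i * ln (u $ i / p $ i) - u $ i * w $ i + u $ i * ln Z" for i
  proof (cases "u $ i = 0")
    case False
    then have u: "u $ i > 0" using prob_simplex_nonneg[OF assms(1), of i] by simp
    then have p: "p $ i > 0" using assms(3) by simp
    have "reweight p w $ i = p $ i * exp (w $ i) / Z" by (simp add: reweight_def Z_def)
    then have "ln (u $ i / reweight p w $ i) = ln (u $ i / p $ i) - w $ i + ln Z"
      using u p Z by (simp add: ln_div ln_mult)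
    then show ?thesis by (simp only:) (simp add: algebra_simps)
  qed simp
  then show ?thesis
    using prob_simplex_sum[OF assms(1)]
    by (simp add: kl_def sum.distrib sum_subtractf inner_vec_def flip: sum_distrib_right Z_def)
qed

text \<open>Using \<open>kl_reweight\<close> once with \<open>u\<close> and once with the tilted
  point itself as comparator eliminates the logarithm of the normalizer.\<close>

lemma kl_reweight_three_point:
  fixes u p w :: "real ^ 'k"
  assumes "u \<in> prob_simplex" "p \<in> prob_simplex" "\<And>i. u $ i > 0 \<Longrightarrow> p $ i > 0"
  shows "kl u (reweight p w) = kl u p - kl (reweight p w) p + (reweight p w - u) \<bullet> w"
proof -
  show ?thesis
    using kl_reweight[OF assms, of w]
      kl_reweight[OF reweight_in_prob_simplex[OF assms(2), of w] assms(2), of w]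
    by (simp add: reweight_pos_iff[OF assms(2)] inner_diff_left kl_self)
qed

text \<open>Here \<open>x\<close> is the extrapolated point, computed from the predicted gradient
  \<open>g'\<close>, and \<open>q\<close> the actual update. Two three-point identities, for
  \<open>q\<close> against \<open>u\<close> and for \<open>x\<close> against \<open>q\<close>, are
  added so that \<open>kl q p\<close> cancels; the remaining entropies are bounded below by squared
  norms.\<close>

lemma kl_extragradient_step:
  fixes u p g g' :: "real ^ 'k"
  assumes "u \<in> prob_simplex" "p \<in> prob_simplex" "\<And>i. u $ i > 0 \<Longrightarrow> p $ i > 0"
    and x: "x = reweight p (\<eta> *\<^sub>R g')" and q: "q = reweight p (\<eta> *\<^sub>R g)"
  shows "kl u q \<le> kl u p - (norm (q - x))\<^sup>2 / 4 - (norm (x - p))\<^sup>2 / 4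
      + \<eta> * ((x - u) \<bullet> g) + \<eta> * ((q - x) \<bullet> (g - g'))"
proof -
  have S: "x \<in> prob_simplex" "q \<in> prob_simplex"
    using x q reweight_in_prob_simplex assms(2) by auto
  have supp: "x $ i > 0 \<longleftrightarrow> p $ i > 0" "q $ i > 0 \<longleftrightarrow> p $ i > 0" for i
    using x q reweight_pos_iff assms(2) by auto
  have 1: "kl u q = kl u p - kl q p + (q - u) \<bullet> (\<eta> *\<^sub>R g)"
    unfolding q by (rule kl_reweight_three_point) (use assms in auto)
  have 2: "kl q x = kl q p - kl x p + (x - q) \<bullet> (\<eta> *\<^sub>R g')"
    unfolding x by (rule kl_reweight_three_point) (use assms S supp in auto)
  have 3: "(norm (q - x))\<^sup>2 / 4 \<le> kl q x" "(norm (x - p))\<^sup>2 / 4 \<le> kl x p"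
    using kl_ge_norm_squared S supp assms(2) by blast+
  have "kl u q = kl u p - kl q x - kl x p + (q - u) \<bullet> (\<eta> *\<^sub>R g) + (x - q) \<bullet> (\<eta> *\<^sub>R g')"
    using 1 2 by simp
  also have "\<dots> = kl u p - kl q x - kl x p + \<eta> * ((x - u) \<bullet> g) + \<eta> * ((q - x) \<bullet> (g - g'))"
    by (simp add: inner_diff_left inner_diff_right algebra_simps)
  finally show ?thesis using 3 by simp
qed

lemma tendsto_kl:
  fixes u p :: "real ^ 'k"
  assumes f: "(f \<longlongrightarrow> p) F" and u: "u \<in> prob_simplex" and supp: "\<And>i. u $ i > 0 \<Longrightarrow> p $ i > 0"
  shows "((\<lambda>x. kl u (f x)) \<longlongrightarrow> kl u p) F"
  unfolding kl_def
proof (rule tendsto_sum)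
  fix i
  show "((\<lambda>x. u $ i * ln (u $ i / f x $ i)) \<longlongrightarrow> u $ i * ln (u $ i / p $ i)) F"
  proof (cases "u $ i = 0")
    case False
    then have "u $ i > 0" using prob_simplex_nonneg[OF u, of i] by simp
    then show ?thesis using supp[of i] by (intro tendsto_intros f) auto
  qed simp
qed

section \<open>The Lyapunov function\<close>

lemma norm_diff_squared_le:
  fixes a b c :: "'a::real_inner"
  shows "(norm (a - c))\<^sup>2 \<le> 2 * (norm (a - b))\<^sup>2 + 2 * (norm (b - c))\<^sup>2"
proof -
  have "0 \<le> (norm ((a - b) - (b - c)))\<^sup>2" by simp
  also have "\<dots> = 2 * (norm (a - b))\<^sup>2 + 2 * (norm (b - c))\<^sup>2 - (norm (a - c))\<^sup>2"
    by (simp add: power2_norm_eq_inner inner_diff_left inner_diff_right inner_commute)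
  finally show ?thesis by simp
qed

lemma bilinear_le_squares:
  fixes A :: "real ^ 'm ^ 'n"
  assumes "\<And>y. norm (A *v y) \<le> K * norm y" "0 \<le> K"
  shows "\<bar>x \<bullet> (A *v y)\<bar> \<le> K / 2 * ((norm x)\<^sup>2 + (norm y)\<^sup>2)"
proof -
  have "\<bar>x \<bullet> (A *v y)\<bar> \<le> norm x * norm (A *v y)" by (rule Cauchy_Schwarz_ineq2)
  also have "\<dots> \<le> norm x * (K * norm y)" by (intro mult_left_mono assms(1)) simp
  also have "\<dots> = K / 2 * (2 * norm x * norm y)" by simp
  also have "\<dots> \<le> K / 2 * ((norm x)\<^sup>2 + (norm y)\<^sup>2)"
    using assms(2) by (intro mult_left_mono sum_squares_bound) auto
  finally show ?thesis .
qed

text \<open>The extragradient inequalities of the two players are added. The saddle property removes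
  the payoff terms, and the prediction errors are absorbed by the quadratic decrease, at the price
  of carrying the distance to the previous iterate.\<close>

lemma lyapunov_decrease:
  fixes A :: "real ^ 'm ^ 'n"
  assumes opt: "optimal_solution A xs ys"
    and K: "\<And>y. norm (A *v y) \<le> K * norm y" "0 \<le> K" and \<eta>: "0 < \<eta>" "\<eta> * K \<le> 1 / 16"
    and P: "P \<in> prob_simplex" "\<And>i. xs $ i > 0 \<Longrightarrow> P $ i > 0"
    and Q: "Q \<in> prob_simplex" "\<And>i. ys $ i > 0 \<Longrightarrow> Q $ i > 0"
    and X: "X = reweight P (\<eta> *\<^sub>R (A *v Y0))" and Y: "Y = reweight Q (\<eta> *\<^sub>R (- transpose A *v X0))"
    and P': "P' = reweight P (\<eta> *\<^sub>R (A *v Y))" and Q': "Q' = reweight Q (\<eta> *\<^sub>R (- transpose A *v X))"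
  shows "kl xs P' + kl ys Q' + ((norm (P' - X))\<^sup>2 + (norm (Q' - Y))\<^sup>2) / 16
      + ((norm (P' - X))\<^sup>2 + (norm (Q' - Y))\<^sup>2 + (norm (X - P))\<^sup>2 + (norm (Y - Q))\<^sup>2) / 8
    \<le> kl xs P + kl ys Q + ((norm (P - X0))\<^sup>2 + (norm (Q - Y0))\<^sup>2) / 16"
proof -
  have S: "xs \<in> prob_simplex" "ys \<in> prob_simplex"
    using opt by (auto simp: optimal_solution_def)
  have XY: "X \<in> prob_simplex" "Y \<in> prob_simplex"
    using X Y P Q reweight_in_prob_simplex by auto
  have dual: "b \<bullet> (- transpose A *v a) = - (a \<bullet> (A *v b))" for a b
    by (simp only: minus_matrix_vector_mult inner_transpose_matrix inner_minus_right)
  have x: "kl xs P' \<le> kl xs P - (norm (P' - X))\<^sup>2 / 4 - (norm (X - P))\<^sup>2 / 4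
      + \<eta> * ((X - xs) \<bullet> (A *v Y)) + \<eta> * ((P' - X) \<bullet> (A *v (Y - Y0)))"
    using kl_extragradient_step[OF S(1) P X P'] by (simp add: matrix_vector_mult_diff_distrib)
  have y: "kl ys Q' \<le> kl ys Q - (norm (Q' - Y))\<^sup>2 / 4 - (norm (Y - Q))\<^sup>2 / 4
      + \<eta> * ((Y - ys) \<bullet> (- transpose A *v X)) + \<eta> * ((Q' - Y) \<bullet> (- transpose A *v (X - X0)))"
    using kl_extragradient_step[OF S(2) Q Y Q'] by (simp only: matrix_vector_mult_diff_distrib)
  \<comment> \<open>The game is zero-sum, so the two occurrences of the payoff at
    \<open>(X, Y)\<close> cancel.\<close>
  have "(X - xs) \<bullet> (A *v Y) + (Y - ys) \<bullet> (- transpose A *v X) = X \<bullet> (A *v ys) - xs \<bullet> (A *v Y)"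
    unfolding dual by (simp add: inner_diff_left inner_diff_right matrix_vector_mult_diff_distrib)
  also have "\<dots> \<le> 0" using opt XY by (auto simp: optimal_solution_def intro: order_trans)
  finally have gap: "\<eta> * ((X - xs) \<bullet> (A *v Y)) + \<eta> * ((Y - ys) \<bullet> (- transpose A *v X)) \<le> 0"
    using \<eta>(1) by (simp add: mult_nonneg_nonpos flip: distrib_left)
  \<comment> \<open>This is where the stepsize bound enters; the factor 1/32 is 1/16 times the 1/2
    from the bilinear estimate.\<close>
  have err: "\<eta> * \<bar>a \<bullet> (A *v b)\<bar> \<le> ((norm a)\<^sup>2 + (norm b)\<^sup>2) / 32" for a b
  proof -
    have "\<eta> * \<bar>a \<bullet> (A *v b)\<bar> \<le> \<eta> * (K / 2 * ((norm a)\<^sup>2 + (norm b)\<^sup>2))"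
      using bilinear_le_squares[OF K] \<eta>(1) by (intro mult_left_mono) auto
    also have "\<dots> = \<eta> * K * (((norm a)\<^sup>2 + (norm b)\<^sup>2) / 2)" by simp
    also have "\<dots> \<le> 1 / 16 * (((norm a)\<^sup>2 + (norm b)\<^sup>2) / 2)"
      using \<eta>(2) by (intro mult_right_mono) auto
    finally show ?thesis by simp
  qed
  have ex: "\<eta> * ((P' - X) \<bullet> (A *v (Y - Y0))) \<le> ((norm (P' - X))\<^sup>2 + (norm (Y - Y0))\<^sup>2) / 32"
    using err[of "P' - X" "Y - Y0"] \<eta>(1) by (smt (verit) mult_left_mono)
  have "\<eta> * - ((X - X0) \<bullet> (A *v (Q' - Y))) \<le> ((norm (X - X0))\<^sup>2 + (norm (Q' - Y))\<^sup>2) / 32"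
    using err[of "X - X0" "Q' - Y"] \<eta>(1) by (smt (verit) mult_left_mono)
  then have ey: "\<eta> * ((Q' - Y) \<bullet> (- transpose A *v (X - X0)))
      \<le> ((norm (X - X0))\<^sup>2 + (norm (Q' - Y))\<^sup>2) / 32"
    unfolding dual .
  have "kl xs P' + kl ys Q' \<le> kl xs P + kl ys Q - (norm (P' - X))\<^sup>2 / 4 - (norm (X - P))\<^sup>2 / 4
      - (norm (Q' - Y))\<^sup>2 / 4 - (norm (Y - Q))\<^sup>2 / 4
      + ((norm (P' - X))\<^sup>2 + (norm (Y - Y0))\<^sup>2) / 32 + ((norm (X - X0))\<^sup>2 + (norm (Q' - Y))\<^sup>2) / 32"
    using x y gap ex ey by argo
  \<comment> \<open>Splitting the distances to \<open>X0\<close> and \<open>Y0\<close> at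
    \<open>P\<close> and \<open>Q\<close> costs 1/16 of each part. The parts ending in
    \<open>X0\<close>, \<open>Y0\<close> are the memory term on the right; the decrements of 1/4 pay
    for everything else, including the new memory term and the surplus of 1/8.\<close>
  then show ?thesis
    using norm_diff_squared_le[of X X0 P] norm_diff_squared_le[of Y Y0 Q]
      zero_le_power2[of "norm (P' - X)"] zero_le_power2[of "norm (Q' - Y)"]
      zero_le_power2[of "norm (X - P)"] zero_le_power2[of "norm (Y - Q)"]
    by argo
qed

text \<open>With \<open>a\<close>, \<open>b\<close> as the iterates at time 1 and \<open>c\<close>,
  \<open>d\<close> as those at time 0, the expression is the initial Lyapunov value. It is
  continuous at the equilibrium and vanishes there, because the equilibrium is fixed by the
  half-step.\<close>

lemma lyapunov_initially_small:
  fixes A :: "real ^ 'm ^ 'n"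
  assumes opt: "optimal_solution A xs ys" and "\<delta> > 0"
  shows "\<forall>\<^sub>F (a, b, c, d) in nhds (xs, ys, xs, ys).
    kl xs (reweight a (- \<eta> *\<^sub>R (A *v d))) + kl ys (reweight b (- \<eta> *\<^sub>R (- transpose A *v c)))
      + ((norm (reweight a (- \<eta> *\<^sub>R (A *v d)) - c))\<^sup>2
        + (norm (reweight b (- \<eta> *\<^sub>R (- transpose A *v c)) - d))\<^sup>2) / 16 < \<delta>"
proof -
  let ?F = "nhds (xs, ys, xs, ys)"
  have S: "xs \<in> prob_simplex" "ys \<in> prob_simplex"
    using opt by (auto simp: optimal_solution_def)
  define a b c d where "a = (\<lambda>z :: (real^'n) \<times> (real^'m) \<times> (real^'n) \<times> (real^'m). fst z)"
    and "b = (\<lambda>z :: (real^'n) \<times> (real^'m) \<times> (real^'n) \<times> (real^'m). fst (snd z))"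
    and "c = (\<lambda>z :: (real^'n) \<times> (real^'m) \<times> (real^'n) \<times> (real^'m). fst (snd (snd z)))"
    and "d = (\<lambda>z :: (real^'n) \<times> (real^'m) \<times> (real^'n) \<times> (real^'m). snd (snd (snd z)))"
  have id: "((\<lambda>z. z) \<longlongrightarrow> (xs, ys, xs, ys)) ?F" by (rule filterlim_ident)
  have lim: "(a \<longlongrightarrow> xs) ?F" "(b \<longlongrightarrow> ys) ?F" "(c \<longlongrightarrow> xs) ?F" "(d \<longlongrightarrow> ys) ?F"
    unfolding a_def b_def c_def d_def
    using tendsto_fst[OF id] tendsto_fst[OF tendsto_snd[OF id]]
      tendsto_fst[OF tendsto_snd[OF tendsto_snd[OF id]]]
      tendsto_snd[OF tendsto_snd[OF tendsto_snd[OF id]]] by simp_all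
  have mv: "((\<lambda>z. M *v f z) \<longlongrightarrow> M *v l) ?F" if "(f \<longlongrightarrow> l) ?F" for M :: "real ^ 'i ^ 'j" and f l
    using bounded_linear.tendsto[OF matrix_vector_mul_bounded_linear that] .
  have fx: "reweight xs (- \<eta> *\<^sub>R (A *v ys)) = xs"
    using complementary_slackness[OF opt]
    by (intro reweight_const_on_support[OF S(1), where c = "- \<eta> * (xs \<bullet> (A *v ys))"]) simp
  have opt': "optimal_solution (- transpose A) ys xs"
    using opt by (simp only: optimal_solution_dual)
  have fy: "reweight ys (- \<eta> *\<^sub>R (- transpose A *v xs)) = ys"
    using complementary_slackness[OF opt']
    by (intro reweight_const_on_support[OF S(2), where c = "- \<eta> * (ys \<bullet> (- transpose A *v xs))"]) simp
  have P: "((\<lambda>z. reweight (a z) (- \<eta> *\<^sub>R (A *v d z))) \<longlongrightarrow> xs) ?F" (is "(?P \<longlongrightarrow> _) _")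
    using tendsto_reweight[OF lim(1) tendsto_scaleR[OF tendsto_const mv[OF lim(4)]] S(1), of "- \<eta>" A]
    unfolding fx .
  have Q: "((\<lambda>z. reweight (b z) (- \<eta> *\<^sub>R (- transpose A *v c z))) \<longlongrightarrow> ys) ?F" (is "(?Q \<longlongrightarrow> _) _")
    using tendsto_reweight[OF lim(2) tendsto_scaleR[OF tendsto_const mv[OF lim(3)]] S(2), of "- \<eta>" "- transpose A"]
    unfolding fy .
  have "((\<lambda>z. kl xs (?P z) + kl ys (?Q z) + ((norm (?P z - c z))\<^sup>2 + (norm (?Q z - d z))\<^sup>2) / 16)
      \<longlongrightarrow> kl xs xs + kl ys ys + ((norm (xs - xs))\<^sup>2 + (norm (ys - ys))\<^sup>2) / 16) ?F"
    by (intro tendsto_intros tendsto_kl P Q lim S) simp_all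
  then have "((\<lambda>z. kl xs (?P z) + kl ys (?Q z) + ((norm (?P z - c z))\<^sup>2 + (norm (?Q z - d z))\<^sup>2) / 16)
      \<longlongrightarrow> 0) ?F"
    by (simp add: kl_self)
  from order_tendstoD(2)[OF this \<open>\<delta> > 0\<close>] show ?thesis
    by (rule eventually_mono) (auto simp: a_def b_def c_def d_def simp del: transpose_matrix_vector)
qed

section \<open>Fixed points near the equilibrium\<close>

lemma support_nearby:
  fixes u :: "real ^ 'k"
  obtains \<rho> where "\<rho> > 0" "\<And>p i. dist p u < \<rho> \<Longrightarrow> u $ i > 0 \<Longrightarrow> p $ i > 0"
proof -
  have "\<forall>\<^sub>F p in nhds u. \<forall>i. u $ i > 0 \<longrightarrow> p $ i > 0"
  proof (rule eventually_all_finite)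
    fix i
    have "((\<lambda>p. p $ i) \<longlongrightarrow> u $ i) (nhds u)" by (intro tendsto_vec_nth filterlim_ident)
    then show "\<forall>\<^sub>F p in nhds u. u $ i > 0 \<longrightarrow> p $ i > 0"
      by (cases "u $ i > 0") (auto dest: order_tendstoD)
  qed
  then show thesis unfolding eventually_nhds_metric using that by blast
qed

text \<open>A fixed point equalizes payoffs on its support, which near \<open>xs\<close> contains
  that of \<open>xs\<close>. On the other coordinates strict complementarity, being an open
  condition, keeps payoffs lower. The radius is chosen before the stepsize and serves all of
  them.\<close>

lemma fixed_point_best_response:
  fixes A :: "real ^ 'm ^ 'n"
  assumes uniq: "unique_optimal_solution A xs ys"
  obtains \<rho> where "\<rho> > 0"
    "\<And>p q \<eta> i. \<lbrakk>dist p xs < \<rho>; dist q ys < \<rho>; p \<in> prob_simplex; \<eta> > 0;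
      reweight p (\<eta> *\<^sub>R (A *v q)) = p\<rbrakk> \<Longrightarrow> (A *v q) $ i \<le> p \<bullet> (A *v q)"
proof -
  have opt: "optimal_solution A xs ys" using uniq by (simp add: unique_optimal_solution_def)
  then have xs: "xs \<in> prob_simplex" by (simp add: optimal_solution_def)
  obtain \<rho>1 where \<rho>1: "\<rho>1 > 0" "\<And>p i. dist p xs < \<rho>1 \<Longrightarrow> xs $ i > 0 \<Longrightarrow> p $ i > 0"
    using support_nearby by blast
  \<comment> \<open>Finitely many strict inequalities, each stable under small changes of
    \<open>q\<close>.\<close>
  have "\<forall>\<^sub>F q in nhds ys. \<forall>i k. xs $ i > 0 \<longrightarrow> xs $ k = 0 \<longrightarrow> (A *v q) $ k < (A *v q) $ i"
  proof (intro eventually_all_finite)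
    fix i k
    show "\<forall>\<^sub>F q in nhds ys. xs $ i > 0 \<longrightarrow> xs $ k = 0 \<longrightarrow> (A *v q) $ k < (A *v q) $ i"
    proof (cases "xs $ i > 0 \<and> xs $ k = 0")
      case True
      have "((\<lambda>q. (A *v q) $ i - (A *v q) $ k) \<longlongrightarrow> (A *v ys) $ i - (A *v ys) $ k) (nhds ys)"
        by (intro tendsto_intros bounded_linear.tendsto[OF matrix_vector_mul_bounded_linear]
            filterlim_ident)
      moreover have "(A *v ys) $ i - (A *v ys) $ k > 0"
        using strict_complementarity[OF uniq, of k] complementary_slackness[OF opt, of i] True by simp
      ultimately show ?thesis using order_tendstoD(1)[of _ _ "nhds ys" 0] by fastforce
    qed auto
  qed
  then obtain \<rho>2 where \<rho>2: "\<rho>2 > 0"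
    "\<And>q i k. \<lbrakk>dist q ys < \<rho>2; xs $ i > 0; xs $ k = 0\<rbrakk> \<Longrightarrow> (A *v q) $ k < (A *v q) $ i"
    unfolding eventually_nhds_metric by blast
  have "\<exists>i. xs $ i \<noteq> 0" using prob_simplex_sum[OF xs] by (metis sum.neutral zero_neq_one)
  then obtain i0 where i0: "xs $ i0 > 0" using prob_simplex_nonneg[OF xs] by (metis less_eq_real_def)
  show thesis
  proof (rule that[of "min \<rho>1 \<rho>2"])
    fix p q k and \<eta> :: real
    assume *: "dist p xs < min \<rho>1 \<rho>2" "dist q ys < min \<rho>1 \<rho>2" "p \<in> prob_simplex" "\<eta> > 0"
      "reweight p (\<eta> *\<^sub>R (A *v q)) = p"
    have p0: "p $ i0 > 0" using \<rho>1(2) i0 *(1) by simp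
    have const: "(A *v q) $ i = (A *v q) $ i0" if "p $ i > 0" for i
      using reweight_fixed_point_support[OF *(3,5) that p0] *(4) by simp
    have "p $ i * (A *v q) $ i = p $ i * (A *v q) $ i0" for i
      using const[of i] prob_simplex_nonneg[OF *(3), of i] by (cases "p $ i = 0") auto
    then have "p \<bullet> (A *v q) = (\<Sum>i\<in>UNIV. p $ i * (A *v q) $ i0)"
      unfolding inner_vec_def inner_real_def by presburger
    then have v: "p \<bullet> (A *v q) = (A *v q) $ i0"
      using prob_simplex_sum[OF *(3)] by (simp flip: sum_distrib_right)
    show "(A *v q) $ k \<le> p \<bullet> (A *v q)"
    proof (cases "xs $ k > 0")
      case True
      then show ?thesis using const[of k] \<rho>1(2) *(1) v by simp
    next
      case False
      then have "xs $ k = 0" using prob_simplex_nonneg[OF xs, of k] by simp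
      then show ?thesis using \<rho>2(2)[of q i0 k] *(2) i0 v by simp
    qed
  qed (use \<rho>1 \<rho>2 in auto)
qed

text \<open>Applying the best-response lemma to the game and to its dual makes a nearby fixed point
  a saddle point, and uniqueness finishes.\<close>

lemma isolated_fixed_point:
  fixes A :: "real ^ 'm ^ 'n"
  assumes uniq: "unique_optimal_solution A xs ys"
  obtains \<rho> where "\<rho> > 0"
    "\<And>p q \<eta>. \<lbrakk>dist p xs < \<rho>; dist q ys < \<rho>; p \<in> prob_simplex; q \<in> prob_simplex; \<eta> > 0;
      reweight p (\<eta> *\<^sub>R (A *v q)) = p; reweight q (\<eta> *\<^sub>R (- transpose A *v p)) = q\<rbrakk>
      \<Longrightarrow> p = xs \<and> q = ys"
proof -
  obtain \<rho>1 where \<rho>1: "\<rho>1 > 0"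
    "\<And>p q \<eta> i. \<lbrakk>dist p xs < \<rho>1; dist q ys < \<rho>1; p \<in> prob_simplex; \<eta> > 0;
      reweight p (\<eta> *\<^sub>R (A *v q)) = p\<rbrakk> \<Longrightarrow> (A *v q) $ i \<le> p \<bullet> (A *v q)"
    using fixed_point_best_response[OF uniq] by blast
  obtain \<rho>2 where \<rho>2: "\<rho>2 > 0"
    "\<And>p q \<eta> i. \<lbrakk>dist p ys < \<rho>2; dist q xs < \<rho>2; p \<in> prob_simplex; \<eta> > 0;
      reweight p (\<eta> *\<^sub>R (- transpose A *v q)) = p\<rbrakk>
      \<Longrightarrow> (- transpose A *v q) $ i \<le> p \<bullet> (- transpose A *v q)"
    using fixed_point_best_response[OF unique_optimal_solution_dual[OF uniq]] by blast
  show thesis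
  proof (rule that[of "min \<rho>1 \<rho>2"])
    fix p q and \<eta> :: real
    assume *: "dist p xs < min \<rho>1 \<rho>2" "dist q ys < min \<rho>1 \<rho>2"
      "p \<in> prob_simplex" "q \<in> prob_simplex" "\<eta> > 0"
      "reweight p (\<eta> *\<^sub>R (A *v q)) = p" "reweight q (\<eta> *\<^sub>R (- transpose A *v p)) = q"
    have "optimal_solution A p q"
    proof (rule optimal_solutionI[OF *(3,4)])
      show "(A *v q) $ i \<le> p \<bullet> (A *v q)" for i
        using \<rho>1(2) * by simp
      have "(- transpose A *v p) $ j \<le> q \<bullet> (- transpose A *v p)" for j
        using \<rho>2(2)[of q p \<eta>] * by (simp del: transpose_matrix_vector)
      then show "p \<bullet> (A *v q) \<le> (transpose A *v p) $ j" for j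
        by (simp add: minus_matrix_vector_mult inner_transpose_matrix del: transpose_matrix_vector)
    qed
    then show "p = xs \<and> q = ys" using uniq by (simp add: unique_optimal_solution_def)
  qed (use \<rho>1 \<rho>2 in auto)
qed

section \<open>Convergence of the dynamics\<close>

lemma omwu_iff_reweight:
  fixes A :: "real ^ 'm ^ 'n"
  shows "omwu A \<eta> X Y \<longleftrightarrow> (\<forall>t\<ge>1.
    X (t + 1) = reweight (X t) (\<eta> *\<^sub>R (2 *\<^sub>R (A *v Y t) - A *v Y (t - 1))) \<and>
    Y (t + 1) = reweight (Y t) (\<eta> *\<^sub>R (2 *\<^sub>R (- transpose A *v X t) - (- transpose A *v X (t - 1)))))"
proof -
  have "\<eta> * (2 * a - b) = 2 * \<eta> * a - \<eta> * b" "\<eta> * (2 * - a - - b) = - 2 * \<eta> * a + \<eta> * b" for a b :: real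
    by (simp_all add: algebra_simps)
  then show ?thesis
    unfolding omwu_def vec_eq_iff reweight_def minus_matrix_vector_mult
    by (simp del: transpose_matrix_vector)
qed

text \<open>\<open>P t\<close> takes back the tilt by the old gradient \<open>g (t - 1)\<close>.
  From it, the old gradient leads to \<open>X t\<close> and the new gradient to
  \<open>P (t + 1)\<close>: an extragradient scheme whose prediction is the previous
  gradient.\<close>

lemma auxiliary_iterates:
  fixes X g :: "nat \<Rightarrow> real ^ 'k" and \<eta> :: real
  defines "P \<equiv> \<lambda>t. reweight (X t) (- \<eta> *\<^sub>R g (t - 1))"
  assumes X1: "X 1 \<in> prob_simplex"
    and step: "\<And>t. t \<ge> 1 \<Longrightarrow> X (t + 1) = reweight (X t) (\<eta> *\<^sub>R (2 *\<^sub>R g t - g (t - 1)))"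
    and t: "t \<ge> 1"
  shows "P t \<in> prob_simplex" "X t = reweight (P t) (\<eta> *\<^sub>R g (t - 1))"
    "P (t + 1) = reweight (P t) (\<eta> *\<^sub>R g t)" "P t $ i > 0 \<longleftrightarrow> X 1 $ i > 0"
proof -
  have X: "X t \<in> prob_simplex \<and> (X t $ i > 0 \<longleftrightarrow> X 1 $ i > 0)"
    using t
  proof (induction t rule: dec_induct)
    case base
    show ?case using X1 by simp
  next
    case (step n)
    then show ?case
      using assms(3)[of n] by (simp add: reweight_in_prob_simplex reweight_pos_iff)
  qed
  show "P t \<in> prob_simplex" unfolding P_def using X reweight_in_prob_simplex by blast
  show "P t $ i > 0 \<longleftrightarrow> X 1 $ i > 0" unfolding P_def using X reweight_pos_iff by blast
  show "X t = reweight (P t) (\<eta> *\<^sub>R g (t - 1))"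
    unfolding P_def using X reweight_const_on_support[of "X t" 0 0] by (simp add: reweight_reweight)
  \<comment> \<open>Since tilts add, the recursion reduces to this identity between
    exponents.\<close>
  have "\<eta> *\<^sub>R (2 *\<^sub>R g t - g (t - 1)) + - \<eta> *\<^sub>R g t = - \<eta> *\<^sub>R g (t - 1) + \<eta> *\<^sub>R g t"
    by (simp add: scaleR_2 algebra_simps del: scaleR_scaleR)
  then show "P (t + 1) = reweight (P t) (\<eta> *\<^sub>R g t)"
    unfolding P_def step[OF t] using X by (simp only: reweight_reweight add_diff_cancel_right')
qed

section \<open>Compactness and limits of sequences\<close>

lemma compact_prob_simplex: "compact (prob_simplex :: (real ^ 'k) set)"
proof -
  have "norm x \<le> real CARD('k)" if "x \<in> prob_simplex" for x :: "real ^ 'k"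
  proof -
    have "norm x \<le> (\<Sum>i\<in>UNIV. \<bar>x $ i\<bar>)" by (rule norm_le_l1_cart)
    also have "\<dots> \<le> (\<Sum>i\<in>(UNIV::'k set). 1)"
      using prob_simplex_nonneg[OF that] prob_simplex_le_1[OF that] by (intro sum_mono) simp
    finally show ?thesis by simp
  qed
  then have "bounded (prob_simplex :: (real ^ 'k) set)" unfolding bounded_iff by blast
  moreover have "closed (prob_simplex :: (real ^ 'k) set)"
    unfolding prob_simplex_def
    by (intro closed_Collect_conj closed_Collect_all closed_Collect_le closed_Collect_eq
        continuous_intros)
  ultimately show ?thesis by (simp add: compact_eq_bounded_closed)
qed

text \<open>Otherwise infinitely many terms stay at distance \<open>e\<close> from \<open>a\<close>,
  and compactness would give them a limit point different from \<open>a\<close>.\<close>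

lemma tendsto_if_unique_limit_point:
  fixes f :: "nat \<Rightarrow> 'a::metric_space"
  assumes "compact K" "\<And>n. f n \<in> K"
    and lp: "\<And>r l. strict_mono (r :: nat \<Rightarrow> nat) \<Longrightarrow> (f \<circ> r) \<longlonglongrightarrow> l \<Longrightarrow> l = a"
  shows "f \<longlonglongrightarrow> a"
proof (rule tendstoI, rule ccontr)
  fix e :: real
  assume "e > 0" and "\<not> (\<forall>\<^sub>F n in sequentially. dist (f n) a < e)"
  then have inf: "infinite {n. \<not> dist (f n) a < e}"
    by (simp add: cofinite_eq_sequentially[symmetric] eventually_cofinite)
  define r where "r = enumerate {n. \<not> dist (f n) a < e}"
  have r: "strict_mono r" "\<And>n. \<not> dist (f (r n)) a < e"
    using strict_mono_enumerate[OF inf] enumerate_in_set[OF inf] by (auto simp: r_def)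
  obtain l r' where r': "strict_mono r'" "((f \<circ> r) \<circ> r') \<longlonglongrightarrow> l"
    using assms(1,2) unfolding compact_def by (metis comp_apply)
  then have "l = a" using lp[of "r \<circ> r'" l] strict_mono_o[OF r(1) r'(1)] by (simp add: o_assoc)
  then have "\<forall>\<^sub>F n in sequentially. dist (f (r (r' n))) a < e"
    using tendstoD[OF r'(2) \<open>e > 0\<close>] by simp
  then show False using r(2) by simp
qed

text \<open>\<open>V\<close> decreases and is bounded below, hence converges; its decrements tend to
  zero and dominate \<open>D\<close>.\<close>

lemma decreasing_gap_tendsto_0:
  fixes V D :: "nat \<Rightarrow> real"
  assumes "\<And>n. V (Suc n) + D n \<le> V n" "\<And>n. 0 \<le> V n" "\<And>n. 0 \<le> D n"
  shows "D \<longlonglongrightarrow> 0"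
proof -
  have "V (Suc n) \<le> V n" for n using assms(1)[of n] assms(3)[of n] by linarith
  then have "decseq V" by (simp add: decseq_Suc_iff)
  then obtain L where L: "V \<longlonglongrightarrow> L"
    using decseq_convergent[of V 0] assms(2) by blast
  have "(\<lambda>n. V n - V (Suc n)) \<longlonglongrightarrow> L - L" by (intro tendsto_diff L LIMSEQ_Suc)
  then have lim: "(\<lambda>n. V n - V (Suc n)) \<longlonglongrightarrow> 0" by simp
  have "D n \<le> V n - V (Suc n)" for n using assms(1)[of n] by linarith
  then show ?thesis
    by (intro tendsto_sandwich[OF _ _ tendsto_const lim]) (use assms(3) in auto)
qed

lemma tendsto_0_if_norm_squared_le:
  fixes f :: "nat \<Rightarrow> 'a::real_normed_vector"
  assumes "D \<longlonglongrightarrow> 0" "\<And>n. (norm (f n))\<^sup>2 \<le> c * D n"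
  shows "f \<longlonglongrightarrow> 0"
proof -
  have "(\<lambda>n. sqrt (c * D n)) \<longlonglongrightarrow> sqrt (c * 0)" by (intro tendsto_intros assms(1))
  then have lim: "(\<lambda>n. sqrt (c * D n)) \<longlonglongrightarrow> 0" by simp
  have "\<forall>n. norm (f n) \<le> sqrt (c * D n)" using assms(2) real_le_rsqrt by blast
  from Lim_null_comparison[OF always_eventually[OF this] lim] show ?thesis .
qed

text \<open>The bound \<open>small\<close> confines the auxiliary sequence to the region where
  \<open>iso\<close> recognizes fixed points; the Lyapunov decrements then show that every limit
  point is one.\<close>

lemma omwu_tendsto:
  fixes A :: "real ^ 'm ^ 'n"
  assumes opt: "optimal_solution A xs ys"
    and K: "\<And>y. norm (A *v y) \<le> K * norm y" "0 \<le> K" and \<eta>: "0 < \<eta>" "\<eta> * K \<le> 1 / 16"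
    and \<rho>: "\<rho> > 0"
    and iso: "\<And>p q. \<lbrakk>dist p xs < \<rho>; dist q ys < \<rho>; p \<in> prob_simplex; q \<in> prob_simplex;
      reweight p (\<eta> *\<^sub>R (A *v q)) = p; reweight q (\<eta> *\<^sub>R (- transpose A *v p)) = q\<rbrakk>
      \<Longrightarrow> p = xs \<and> q = ys"
    and om: "omwu A \<eta> X Y" and init: "X 1 \<in> prob_simplex" "Y 1 \<in> prob_simplex"
    and supp: "\<And>i. xs $ i > 0 \<Longrightarrow> X 1 $ i > 0" "\<And>i. ys $ i > 0 \<Longrightarrow> Y 1 $ i > 0"
    and small: "kl xs (reweight (X 1) (- \<eta> *\<^sub>R (A *v Y 0)))
      + kl ys (reweight (Y 1) (- \<eta> *\<^sub>R (- transpose A *v X 0)))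
      + ((norm (reweight (X 1) (- \<eta> *\<^sub>R (A *v Y 0)) - X 0))\<^sup>2
        + (norm (reweight (Y 1) (- \<eta> *\<^sub>R (- transpose A *v X 0)) - Y 0))\<^sup>2) / 16 < \<rho>\<^sup>2 / 16"
  shows "X \<longlonglongrightarrow> xs \<and> Y \<longlonglongrightarrow> ys"
proof -
  have S: "xs \<in> prob_simplex" "ys \<in> prob_simplex"
    using opt by (auto simp: optimal_solution_def)
  define P where "P t = reweight (X t) (- \<eta> *\<^sub>R (A *v Y (t - 1)))" for t
  define Q where "Q t = reweight (Y t) (- \<eta> *\<^sub>R (- transpose A *v X (t - 1)))" for t
  have stX: "X (t + 1) = reweight (X t) (\<eta> *\<^sub>R (2 *\<^sub>R (A *v Y t) - A *v Y (t - 1)))"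
    and stY: "Y (t + 1) = reweight (Y t)
      (\<eta> *\<^sub>R (2 *\<^sub>R (- transpose A *v X t) - (- transpose A *v X (t - 1))))" if "t \<ge> 1" for t
    using om that unfolding omwu_iff_reweight by blast+
  note auxX = auxiliary_iterates[where X = X and g = "\<lambda>t. A *v Y t" and \<eta> = \<eta>,
      OF init(1) stX, folded P_def]
  note auxY = auxiliary_iterates[where X = Y and g = "\<lambda>t. - transpose A *v X t" and \<eta> = \<eta>,
      OF init(2) stY, folded Q_def]
  \<comment> \<open>The shift removes \<open>t - 1\<close>: \<open>p n\<close> is the auxiliary
    point between \<open>X n\<close> and \<open>X (Suc n)\<close>.\<close>
  define p q where "p n = P (Suc n)" and "q n = Q (Suc n)" for n
  have p: "p n \<in> prob_simplex" "X (Suc n) = reweight (p n) (\<eta> *\<^sub>R (A *v Y n))"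
    "p (Suc n) = reweight (p n) (\<eta> *\<^sub>R (A *v Y (Suc n)))" "xs $ i > 0 \<Longrightarrow> p n $ i > 0" for n i
    using auxX[of "Suc n"] supp by (simp_all add: p_def)
  have q: "q n \<in> prob_simplex" "Y (Suc n) = reweight (q n) (\<eta> *\<^sub>R (- transpose A *v X n))"
    "q (Suc n) = reweight (q n) (\<eta> *\<^sub>R (- transpose A *v X (Suc n)))"
    "ys $ i > 0 \<Longrightarrow> q n $ i > 0" for n i
    using auxY[of "Suc n"] supp by (simp_all add: q_def del: transpose_matrix_vector)
  define V where "V n = kl xs (p n) + kl ys (q n)
    + ((norm (p n - X n))\<^sup>2 + (norm (q n - Y n))\<^sup>2) / 16" for n
  define D where "D n = ((norm (p (Suc n) - X (Suc n)))\<^sup>2 + (norm (q (Suc n) - Y (Suc n)))\<^sup>2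
    + (norm (X (Suc n) - p n))\<^sup>2 + (norm (Y (Suc n) - q n))\<^sup>2) / 8" for n
  have dec: "V (Suc n) + D n \<le> V n" for n
    unfolding V_def D_def
    by (rule lyapunov_decrease[OF opt K \<eta> p(1) p(4) q(1) q(4) p(2) q(2) p(3) q(3)])
  have D0: "0 \<le> D n" for n by (simp add: D_def)
  have klp: "(norm (xs - p n))\<^sup>2 / 4 \<le> kl xs (p n)" and klq: "(norm (ys - q n))\<^sup>2 / 4 \<le> kl ys (q n)" for n
    by (intro kl_ge_norm_squared S p q; simp)+
  have kl0: "0 \<le> kl xs (p n)" "0 \<le> kl ys (q n)" for n
    using klp[of n] klq[of n] zero_le_power2[of "norm (xs - p n)"] zero_le_power2[of "norm (ys - q n)"]
    by linarith+
  have V0: "0 \<le> V n" for n unfolding V_def using kl0[of n] by simp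
  have "V n \<le> V 0" for n
  proof (induction n)
    case (Suc n)
    then show ?case using dec[of n] D0[of n] by linarith
  qed simp
  moreover have "V 0 < \<rho>\<^sup>2 / 16"
    using small by (simp add: V_def p_def q_def P_def Q_def del: transpose_matrix_vector)
  ultimately have V: "V n < \<rho>\<^sup>2 / 16" for n by (rule le_less_trans)
  \<comment> \<open>The threshold for \<open>V\<close> is chosen so that the entropy bound yields
    half the radius, leaving room to pass to limits.\<close>
  have sq: "norm z \<le> \<rho> / 2" if "(norm z)\<^sup>2 / 4 \<le> \<rho>\<^sup>2 / 16" for z :: "'a::real_normed_vector"
    using that \<rho> power2_le_imp_le[of "norm z" "\<rho> / 2"] by (simp add: power_divide)
  have near_p: "dist (p n) xs \<le> \<rho> / 2" for n
  proof -
    have "kl xs (p n) \<le> V n" unfolding V_def using kl0[of n] by simp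
    then have "(norm (xs - p n))\<^sup>2 / 4 \<le> \<rho>\<^sup>2 / 16" using klp[of n] V[of n] by linarith
    then show ?thesis using sq by (metis dist_norm norm_minus_commute)
  qed
  have near_q: "dist (q n) ys \<le> \<rho> / 2" for n
  proof -
    have "kl ys (q n) \<le> V n" unfolding V_def using kl0[of n] by simp
    then have "(norm (ys - q n))\<^sup>2 / 4 \<le> \<rho>\<^sup>2 / 16" using klq[of n] V[of n] by linarith
    then show ?thesis using sq by (metis dist_norm norm_minus_commute)
  qed
  have D: "D \<longlonglongrightarrow> 0" using decreasing_gap_tendsto_0[of V D] dec V0 D0 by blast
  \<comment> \<open>The factor 8 undoes the division by 8 in \<open>D\<close>.\<close>
  have gaps: "(\<lambda>n. p (Suc n) - X (Suc n)) \<longlonglongrightarrow> 0" "(\<lambda>n. q (Suc n) - Y (Suc n)) \<longlonglongrightarrow> 0"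
    "(\<lambda>n. X (Suc n) - p n) \<longlonglongrightarrow> 0" "(\<lambda>n. Y (Suc n) - q n) \<longlonglongrightarrow> 0"
    by (rule tendsto_0_if_norm_squared_le[OF D, where c = 8], simp add: D_def)+
  have lim: "(\<lambda>n. (p n, q n)) \<longlonglongrightarrow> (xs, ys)"
  proof (rule tendsto_if_unique_limit_point)
    show "compact ((prob_simplex :: (real ^ 'n) set) \<times> (prob_simplex :: (real ^ 'm) set))"
      by (intro compact_Times compact_prob_simplex)
    show "(p n, q n) \<in> prob_simplex \<times> prob_simplex" for n using p(1) q(1) by simp
    fix r :: "nat \<Rightarrow> nat" and l
    assume r: "strict_mono r" "((\<lambda>n. (p n, q n)) \<circ> r) \<longlonglongrightarrow> l"
    obtain a b where l: "l = (a, b)" by (cases l)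
    have pa: "(\<lambda>n. p (r n)) \<longlonglongrightarrow> a" and qb: "(\<lambda>n. q (r n)) \<longlonglongrightarrow> b"
      using tendsto_fst[OF r(2)] tendsto_snd[OF r(2)] by (simp_all add: l o_def)
    have a: "a \<in> prob_simplex" and b: "b \<in> prob_simplex"
      using closed_sequentially[OF compact_imp_closed[OF compact_prob_simplex] _ pa]
        closed_sequentially[OF compact_imp_closed[OF compact_prob_simplex] _ qb] p(1) q(1) by auto
    note sub = LIMSEQ_subseq_LIMSEQ[OF _ r(1), unfolded o_def]
    \<comment> \<open>Vanishing gaps force the OMWU iterates and the next auxiliary points to the
      same limit along the subsequence, so the recursion becomes a fixed-point equation.\<close>
    have Xa: "(\<lambda>n. X (Suc (r n))) \<longlonglongrightarrow> a" and Yb: "(\<lambda>n. Y (Suc (r n))) \<longlonglongrightarrow> b"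
      using tendsto_add[OF sub[OF gaps(3)] pa] tendsto_add[OF sub[OF gaps(4)] qb] by simp_all
    have p'a: "(\<lambda>n. p (Suc (r n))) \<longlonglongrightarrow> a" and q'b: "(\<lambda>n. q (Suc (r n))) \<longlonglongrightarrow> b"
      using tendsto_add[OF sub[OF gaps(1)] Xa] tendsto_add[OF sub[OF gaps(2)] Yb] by simp_all
    note mv = tendsto_scaleR[OF tendsto_const
        bounded_linear.tendsto[OF matrix_vector_mul_bounded_linear]]
    have "(\<lambda>n. p (Suc (r n))) \<longlonglongrightarrow> reweight a (\<eta> *\<^sub>R (A *v b))"
      unfolding p(3) by (intro tendsto_reweight[OF pa _ a] mv Yb)
    then have fa: "reweight a (\<eta> *\<^sub>R (A *v b)) = a" using p'a LIMSEQ_unique by blast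
    have "(\<lambda>n. q (Suc (r n))) \<longlonglongrightarrow> reweight b (\<eta> *\<^sub>R (- transpose A *v a))"
      unfolding q(3) by (intro tendsto_reweight[OF qb _ b] mv Xa)
    then have fb: "reweight b (\<eta> *\<^sub>R (- transpose A *v a)) = b" using q'b LIMSEQ_unique by blast
    \<comment> \<open>Only the non-strict bound survives the limit; it still gives the strict
      inequality with radius \<open>\<rho>\<close>.\<close>
    have "dist a xs \<le> \<rho> / 2"
      by (rule LIMSEQ_le_const2[OF tendsto_dist[OF pa tendsto_const]]) (use near_p in blast)
    moreover have "dist b ys \<le> \<rho> / 2"
      by (rule LIMSEQ_le_const2[OF tendsto_dist[OF qb tendsto_const]]) (use near_q in blast)
    ultimately show "l = (xs, ys)" using iso[OF _ _ a b fa fb] \<rho> l by simp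
  qed
  have "p \<longlonglongrightarrow> xs" and "q \<longlonglongrightarrow> ys"
    using tendsto_fst[OF lim] tendsto_snd[OF lim] by simp_all
  from tendsto_add[OF gaps(3) this(1)] tendsto_add[OF gaps(4) this(2)]
  have "(\<lambda>n. X (Suc n)) \<longlonglongrightarrow> xs" "(\<lambda>n. Y (Suc n)) \<longlonglongrightarrow> ys" by simp_all
  then show ?thesis by (intro conjI) (rule LIMSEQ_imp_Suc, assumption)+
qed

theorem theorem3p3:
  fixes A :: "real ^ 'm ^ 'n" and xs :: "real ^ 'n" and ys :: "real ^ 'm"
  assumes "unique_optimal_solution A xs ys"
  shows "\<exists>\<eta>\<^sub>0\<in>{0<..<1}. \<forall>\<eta>. 0 < \<eta> \<and> \<eta> < \<eta>\<^sub>0 \<longrightarrow>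
    (\<exists>U. (\<exists>r>0. U = ball (xs, ys, xs, ys) r \<inter>
              (prob_simplex \<times> prob_simplex \<times> prob_simplex \<times> prob_simplex)) \<and>
      (\<forall>X Y. omwu A \<eta> X Y \<and> (X 1, Y 1, X 0, Y 0) \<in> U \<longrightarrow>
        ((\<lambda>t. (X t, Y t, X (t - 1), Y (t - 1))) \<longlonglongrightarrow> (xs, ys, xs, ys))))"
proof -
  have opt: "optimal_solution A xs ys" using assms by (simp add: unique_optimal_solution_def)
  obtain K where K: "K > 0" "\<And>y. norm (A *v y) \<le> K * norm y"
    using bounded_linear.pos_bounded[OF matrix_vector_mul_bounded_linear[of A]]
    by (metis mult.commute)
  obtain \<rho> where \<rho>: "\<rho> > 0"
    "\<And>p q \<eta>. \<lbrakk>dist p xs < \<rho>; dist q ys < \<rho>; p \<in> prob_simplex; q \<in> prob_simplex; \<eta> > 0;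
      reweight p (\<eta> *\<^sub>R (A *v q)) = p; reweight q (\<eta> *\<^sub>R (- transpose A *v p)) = q\<rbrakk>
      \<Longrightarrow> p = xs \<and> q = ys"
    using isolated_fixed_point[OF assms] by blast
  obtain \<rho>x where \<rho>x: "\<rho>x > 0" "\<And>p i. dist p xs < \<rho>x \<Longrightarrow> xs $ i > 0 \<Longrightarrow> p $ i > 0"
    using support_nearby by blast
  obtain \<rho>y where \<rho>y: "\<rho>y > 0" "\<And>p i. dist p ys < \<rho>y \<Longrightarrow> ys $ i > 0 \<Longrightarrow> p $ i > 0"
    using support_nearby by blast
  show ?thesis
  \<comment> \<open>The second entry enforces the stepsize bound 1/16 of the Lyapunov lemma; the
    first keeps the threshold below 1.\<close>
  proof (intro bexI[of _ "min (1 / 2) (1 / (16 * K))"] allI impI)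
    show "min (1 / 2) (1 / (16 * K)) \<in> {0<..<1}" using K(1) by simp
    fix \<eta> :: real
    assume "0 < \<eta> \<and> \<eta> < min (1 / 2) (1 / (16 * K))"
    then have \<eta>: "0 < \<eta>" "\<eta> * K \<le> 1 / 16" using K(1) by (auto simp: field_simps)
    have "\<rho>\<^sup>2 / 16 > 0" using \<rho>(1) by simp
    from lyapunov_initially_small[OF opt this, of \<eta>]
    obtain r0 where r0: "r0 > 0"
      "\<And>a b c d. dist (a, b, c, d) (xs, ys, xs, ys) < r0 \<Longrightarrow>
        kl xs (reweight a (- \<eta> *\<^sub>R (A *v d))) + kl ys (reweight b (- \<eta> *\<^sub>R (- transpose A *v c)))
          + ((norm (reweight a (- \<eta> *\<^sub>R (A *v d)) - c))\<^sup>2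
            + (norm (reweight b (- \<eta> *\<^sub>R (- transpose A *v c)) - d))\<^sup>2) / 16 < \<rho>\<^sup>2 / 16"
      unfolding eventually_nhds_metric by (auto simp del: transpose_matrix_vector)
    \<comment> \<open>\<open>r0\<close> makes the initial Lyapunov value small, while
      \<open>\<rho>x\<close> and \<open>\<rho>y\<close> keep the equilibrium supports inside those
      of the starting strategies.\<close>
    define r where "r = min r0 (min \<rho>x \<rho>y)"
    have r: "r > 0" using r0(1) \<rho>x(1) \<rho>y(1) by (simp add: r_def)
    define U where "U = ball (xs, ys, xs, ys) r \<inter>
      (prob_simplex \<times> prob_simplex \<times> prob_simplex \<times> prob_simplex)"
    have "(\<lambda>t. (X t, Y t, X (t - 1), Y (t - 1))) \<longlonglongrightarrow> (xs, ys, xs, ys)"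
      if om: "omwu A \<eta> X Y" and XU: "(X 1, Y 1, X 0, Y 0) \<in> U" for X Y
    proof -
      have init: "X 1 \<in> prob_simplex" "Y 1 \<in> prob_simplex"
        and d: "dist (X 1, Y 1, X 0, Y 0) (xs, ys, xs, ys) < r"
        using XU by (auto simp: U_def dist_commute)
      have "dist (X 1) xs < r" "dist (Y 1) ys < r"
        using d dist_fst_le[of "(X 1, Y 1, X 0, Y 0)" "(xs, ys, xs, ys)"]
          dist_snd_le[of "(X 1, Y 1, X 0, Y 0)" "(xs, ys, xs, ys)"]
          dist_fst_le[of "(Y 1, X 0, Y 0)" "(ys, xs, ys)"] by simp_all
      then have supp: "\<And>i. xs $ i > 0 \<Longrightarrow> X 1 $ i > 0" "\<And>i. ys $ i > 0 \<Longrightarrow> Y 1 $ i > 0"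
        using \<rho>x(2) \<rho>y(2) by (simp_all add: r_def)
      have d0: "dist (X 1, Y 1, X 0, Y 0) (xs, ys, xs, ys) < r0" using d by (simp add: r_def)
      have "X \<longlonglongrightarrow> xs \<and> Y \<longlonglongrightarrow> ys"
        by (rule omwu_tendsto[OF opt K(2) less_imp_le[OF K(1)] \<eta> \<rho>(1) \<rho>(2)[OF _ _ _ _ \<eta>(1)]
              om init supp r0(2)[OF d0]])
      then have lim: "X \<longlonglongrightarrow> xs" "Y \<longlonglongrightarrow> ys" by auto
      \<comment> \<open>Truncated subtraction affects only \<open>t = 0\<close>; shifting the index
        by one restores the original sequences.\<close>
      have "(\<lambda>t. X (t - 1)) \<longlonglongrightarrow> xs" "(\<lambda>t. Y (t - 1)) \<longlonglongrightarrow> ys"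
        by (rule LIMSEQ_imp_Suc, simp add: lim)+
      then show ?thesis by (intro tendsto_Pair lim)
    qed
    then show "\<exists>U. (\<exists>r>0. U = ball (xs, ys, xs, ys) r \<inter>
              (prob_simplex \<times> prob_simplex \<times> prob_simplex \<times> prob_simplex)) \<and>
      (\<forall>X Y. omwu A \<eta> X Y \<and> (X 1, Y 1, X 0, Y 0) \<in> U \<longrightarrow>
        ((\<lambda>t. (X t, Y t, X (t - 1), Y (t - 1))) \<longlonglongrightarrow> (xs, ys, xs, ys)))"
      using r U_def by blast
  qed
qed

end
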